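(* Let $T_1\in A_1\otimes B_1\otimes C_1$ and $T_2\in A_2\otimes B_2\otimes C_2$ be such that $\mathbf R(T_1)$ can be determined by the substitution method. Then Strassen's additivity conjecture holds for $T_1\oplus T_2$, i.e. $\mathbf R(T_1\oplus T_2)=\mathbf R(T_1)+\mathbf R(T_2)$.
   Context: All vector spaces are finite-dimensional over $\mathbb{C}$. $\mathbf R(T)$ is the tensor rank: the least $r$ such that $T$ is a sum of $r$ tensors $a\otimes b\otimes c$. $T_1\oplus T_2$ is the tensor $T_1+T_2\in(A_1\oplus A_2)\otimes(B_1\oplus B_2)\otimes(C_1\oplus C_2)$. The substitution method. One round, applied to $T\in A\otimes B\otimes C$, is as follows. Distinguish one of the three factors, say $A$, take a basis $\{a_j\}$ of it and bases $\{\beta_s\}$, $\{\gamma_t\}$ of $B^*$, $C^*$, and represent $T$ by the matrix $M$ with entries $M_{s,t}=T(\beta_s\otimes\gamma_t)\in A$, regarded as linear forms in the formal variables $a_j$. Choose a set of $p$ rows and $q$ columns of $M$. Inductively, in some order, for each chosen row (resp. column), remove it, and add to every other remaining row (resp. column) a multiple of it by an arbitrary coefficient $\lambda$ (the coefficients depend on the row or column to which it is added); it is required that, for every choice of these coefficients, each row or column is nonzero at the moment it is removed. Then set to zero all $a_j$ that appear in any of the selected rows or columns, obtaining a matrix $M'$ on the unselected rows and columns (it does not depend on the choices of $\lambda$), with corresponding tensor $T'$. The round yields the lower bound $\mathbf R(T)\ge p+q+\mathbf R(T')$. Rounds can be iterated, interchanging the roles of $A,B,C$. We say $\mathbf R(T)$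 can be determined by the substitution method if there is a finite sequence of rounds $T=T^{(0)}\to T^{(1)}\to\cdots\to T^{(N)}=0$, the $i$-th selecting $p_i$ rows and $q_i$ columns, such that the resulting lower bound is sharp: $\mathbf R(T)=\sum_{i=1}^N(p_i+q_i)$. *)

theory Defs
  imports Complex_Main
begin

text \<open>
  A finite-dimensional complex vector space is presented as \<open>\<complex>\<^sup>I\<close> for a finite index set \<open>I\<close>: its
  vectors are functions on the index type, and only their values on \<open>I\<close> count. The dual of
  \<open>\<complex>\<^sup>I\<close> is again \<open>\<complex>\<^sup>I\<close>, the functional \<open>\<beta>\<close> being \<open>v \<mapsto> (\<Sum>i\<in>I. \<beta> i * v i)\<close>. Accordingly
  a tensor in \<open>\<complex>\<^sup>I \<otimes> \<complex>\<^sup>J \<otimes> \<complex>\<^sup>K\<close> is its array of coordinates, of which only the values on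
  \<open>I \<times> J \<times> K\<close> count. Arbitrary index sets are used (rather than initial segments of the naturals)
  so that coordinates can be discarded without renumbering; an empty index set gives the zero space.
\<close>

type_synonym ('a, 'b, 'c) tensor = "'a \<Rightarrow> 'b \<Rightarrow> 'c \<Rightarrow> complex"

definition simple_tensor ::
  "('a \<Rightarrow> complex) \<Rightarrow> ('b \<Rightarrow> complex) \<Rightarrow> ('c \<Rightarrow> complex) \<Rightarrow> ('a, 'b, 'c) tensor" where
  "simple_tensor a b c = (\<lambda>i j k. a i * b j * c k)"

definition tensor_rank ::
  "'a set \<Rightarrow> 'b set \<Rightarrow> 'c set \<Rightarrow> ('a, 'b, 'c) tensor \<Rightarrow> nat" where
  "tensor_rank I J K T = (LEAST r. \<exists>a b c.
     \<forall>i\<in>I. \<forall>j\<in>J. \<forall>k\<in>K. T i j k = (\<Sum>m<r. simple_tensor (a m) (b m) (c m) i j k))"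

text \<open>\<open>\<complex>\<^sup>I\<^sup>1 \<oplus> \<complex>\<^sup>I\<^sup>2\<close> is \<open>\<complex>\<^sup>I\<close> with \<open>I = I1 <+> I2\<close>.\<close>

fun tensor_direct_sum ::
  "('a1, 'b1, 'c1) tensor \<Rightarrow> ('a2, 'b2, 'c2) tensor \<Rightarrow>
   ('a1 + 'a2, 'b1 + 'b2, 'c1 + 'c2) tensor" where
  "tensor_direct_sum T1 T2 (Inl i) (Inl j) (Inl k) = T1 i j k"
| "tensor_direct_sum T1 T2 (Inr i) (Inr j) (Inr k) = T2 i j k"
| "tensor_direct_sum T1 T2 _ _ _ = 0"

text \<open>
  Bases of \<open>\<complex>\<^sup>I\<close> are labelled by \<open>I\<close> itself, which is no restriction since the labels are immaterial.
\<close>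

definition is_basis :: "'a set \<Rightarrow> ('a \<Rightarrow> 'a \<Rightarrow> complex) \<Rightarrow> bool" where
  "is_basis I f \<longleftrightarrow>
     (\<forall>c. (\<forall>i\<in>I. (\<Sum>l\<in>I. c l * f l i) = 0) \<longrightarrow> (\<forall>l\<in>I. c l = 0)) \<and>
     (\<forall>v. \<exists>c. \<forall>i\<in>I. v i = (\<Sum>l\<in>I. c l * f l i))"

definition contract ::
  "'b set \<Rightarrow> 'c set \<Rightarrow> ('a, 'b, 'c) tensor \<Rightarrow> ('b \<Rightarrow> complex) \<Rightarrow> ('c \<Rightarrow> complex) \<Rightarrow> 'a \<Rightarrow> complex"
  where "contract J K T \<beta> \<gamma> = (\<lambda>i. \<Sum>j\<in>J. \<Sum>k\<in>K. T i j k * \<beta> j * \<gamma> k)"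

text \<open>
  A matrix of linear forms: \<open>M s t l\<close> is the coefficient of the formal variable \<open>a\<^sub>l\<close> in the entry in
  row \<open>s\<close> and column \<open>t\<close>.
\<close>

type_synonym ('a, 'b, 'c) form_matrix = "'b \<Rightarrow> 'c \<Rightarrow> 'a \<Rightarrow> complex"

definition represents ::
  "'a set \<Rightarrow> 'b set \<Rightarrow> 'c set \<Rightarrow> ('a, 'b, 'c) tensor \<Rightarrow>
   ('a \<Rightarrow> 'a \<Rightarrow> complex) \<Rightarrow> ('b \<Rightarrow> 'b \<Rightarrow> complex) \<Rightarrow> ('c \<Rightarrow> 'c \<Rightarrow> complex) \<Rightarrow>
   ('a, 'b, 'c) form_matrix \<Rightarrow> bool" where
  "represents I J K T a \<beta> \<gamma> M \<longleftrightarrow>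
     (\<forall>s\<in>J. \<forall>t\<in>K. \<forall>i\<in>I. contract J K T (\<beta> s) (\<gamma> t) i = (\<Sum>l\<in>I. M s t l * a l i))"

text \<open>
  \<open>removable I R S ops M\<close>: in the matrix \<open>M\<close> with remaining rows \<open>R\<close>, remaining columns \<open>S\<close> and
  formal variables \<open>I\<close>, the rows (\<open>Inl\<close>) and columns (\<open>Inr\<close>) listed in \<open>ops\<close> can be removed one
  after the other, each being nonzero at the moment it is removed, whatever multiples
  \<open>\<lambda>\<close> of the removed lines are added to the remaining ones (selected or not).
\<close>

fun removable ::
  "'a set \<Rightarrow> 'b set \<Rightarrow> 'c set \<Rightarrow> ('b + 'c) list \<Rightarrow> ('a, 'b, 'c) form_matrix \<Rightarrow> bool" where
  "removable I R S [] M \<longleftrightarrow> True"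
| "removable I R S (Inl r # ops) M \<longleftrightarrow>
     (\<exists>t\<in>S. \<exists>l\<in>I. M r t l \<noteq> 0) \<and>
     (\<forall>lam :: 'b \<Rightarrow> complex.
        removable I (R - {r}) S ops (\<lambda>s t l. M s t l + lam s * M r t l))"
| "removable I R S (Inr q # ops) M \<longleftrightarrow>
     (\<exists>s\<in>R. \<exists>l\<in>I. M s q l \<noteq> 0) \<and>
     (\<forall>lam :: 'c \<Rightarrow> complex.
        removable I R (S - {q}) ops (\<lambda>s t l. M s t l + lam t * M s q l))"

text \<open>
  The formal variables that survive a round selecting the rows \<open>P\<close> and the columns \<open>Q\<close>, i.e. those
  appearing in no selected row or column of the original matrix. (Taking instead the
  variables that can appear in a line at the moment of its removal gives the same set: the choice
  \<open>\<lambda> = 0\<close> shows every entry of a selected line when the first line through it is removed.)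
\<close>

definition surviving ::
  "'a set \<Rightarrow> 'b set \<Rightarrow> 'c set \<Rightarrow> 'b set \<Rightarrow> 'c set \<Rightarrow> ('a, 'b, 'c) form_matrix \<Rightarrow> 'a set" where
  "surviving I J K P Q M =
     {l \<in> I. (\<forall>s\<in>P. \<forall>t\<in>K. M s t l = 0) \<and> (\<forall>s\<in>J. \<forall>t\<in>Q. M s t l = 0)}"

text \<open>
  \<open>subst_round I J K T p q I' J' K' T'\<close>: one round with the first factor distinguished, selecting
  \<open>p\<close> rows and \<open>q\<close> columns, leads from \<open>T\<close> in \<open>\<complex>\<^sup>I \<otimes> \<complex>\<^sup>J \<otimes> \<complex>\<^sup>K\<close> to \<open>T'\<close> in
  \<open>\<complex>\<^sup>I\<^sup>' \<otimes> \<complex>\<^sup>J\<^sup>' \<otimes> \<complex>\<^sup>K\<^sup>'\<close>.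
\<close>

definition subst_round ::
  "'a set \<Rightarrow> 'b set \<Rightarrow> 'c set \<Rightarrow> ('a, 'b, 'c) tensor \<Rightarrow> nat \<Rightarrow> nat \<Rightarrow>
   'a set \<Rightarrow> 'b set \<Rightarrow> 'c set \<Rightarrow> ('a, 'b, 'c) tensor \<Rightarrow> bool" where
  "subst_round I J K T p q I' J' K' T' \<longleftrightarrow>
     (\<exists>a \<beta> \<gamma> M P Q ops.
        is_basis I a \<and> is_basis J \<beta> \<and> is_basis K \<gamma> \<and> represents I J K T a \<beta> \<gamma> M \<and>
        P \<subseteq> J \<and> card P = p \<and> Q \<subseteq> K \<and> card Q = q \<and>
        distinct ops \<and> set ops = P <+> Q \<and> removable I J K ops M \<and>
        I' = surviving I J K P Q M \<and> J' = J - P \<and> K' = K - Q \<and>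
        (\<forall>l\<in>I'. \<forall>s\<in>J'. \<forall>t\<in>K'. T' l s t = M s t l))"

text \<open>
  \<open>subst_bound I J K T n\<close>: a finite sequence of rounds leads from \<open>T\<close> to a zero tensor and selects
  \<open>n\<close> rows and columns in total. The last two rules distinguish the second and the third factor
  (exchanging rows with columns makes no difference in \<open>subst_round\<close>).
\<close>

inductive subst_bound ::
  "'a set \<Rightarrow> 'b set \<Rightarrow> 'c set \<Rightarrow> ('a, 'b, 'c) tensor \<Rightarrow> nat \<Rightarrow> bool" where
  zero: "\<forall>i\<in>I. \<forall>j\<in>J. \<forall>k\<in>K. T i j k = 0 \<Longrightarrow> subst_bound I J K T 0"
| round_A: "subst_round I J K T p q I' J' K' T' \<Longrightarrow>
     subst_bound I' J' K' T' n \<Longrightarrow> subst_bound I J K T (p + q + n)"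
| round_B: "subst_round J I K (\<lambda>j i k. T i j k) p q J' I' K' (\<lambda>j i k. T' i j k) \<Longrightarrow>
     subst_bound I' J' K' T' n \<Longrightarrow> subst_bound I J K T (p + q + n)"
| round_C: "subst_round K I J (\<lambda>k i j. T i j k) p q K' I' J' (\<lambda>k i j. T' i j k) \<Longrightarrow>
     subst_bound I' J' K' T' n \<Longrightarrow> subst_bound I J K T (p + q + n)"

definition rank_determined_by_substitution ::
  "'a set \<Rightarrow> 'b set \<Rightarrow> 'c set \<Rightarrow> ('a, 'b, 'c) tensor \<Rightarrow> bool" where
  "rank_determined_by_substitution I J K T \<longleftrightarrow> subst_bound I J K T (tensor_rank I J K T)"

end

(* Fix a decomposition of T1 \<oplus> T2 into r simple tensors. If a row of the T1-block is nonzero, some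
   term of the decomposition is nonzero at it, and adding suitable multiples of this row to all the
   others, those of T2 included, kills that term. The T1-block then undergoes one step of the
   substitution method, while T2 gets polluted; but the pollution is a combination of
   selected lines, which vanish once the formal variables occurring in them are set to zero. Hence a
   round costs p + q terms and leads to a decomposition of T1' \<oplus> T2. *)

theory Submission
  imports Defs
begin

section \<open>Decompositions into a given number of simple tensors\<close>

text \<open>This is the relation R(T) \<le> \<open>r\<close>, since terms may be zero. It lets
  decompositions be transformed step by step, leaving the minimum to the very end.\<close>

definition rank_at_most ::
  "'a set \<Rightarrow> 'b set \<Rightarrow> 'c set \<Rightarrow> ('a, 'b, 'c) tensor \<Rightarrow> nat \<Rightarrow> bool" where
  "rank_at_most I J K T r \<longleftrightarrow> (\<exists>a b c.
     \<forall>i\<in>I. \<forall>j\<in>J. \<forall>k\<in>K. T i j k = (\<Sum>m<r. a m i * b m j * c m k))"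

text \<open>Restricting the vectors of a decomposition covers both discarding coordinates and
  changing a tensor outside the index sets that count.\<close>

lemma rank_at_most_cong:
  assumes "rank_at_most I J K T r"
    and "\<And>i j k. i \<in> I' \<Longrightarrow> j \<in> J' \<Longrightarrow> k \<in> K' \<Longrightarrow> T' i j k = T i j k"
    and "I' \<subseteq> I" "J' \<subseteq> J" "K' \<subseteq> K"
  shows "rank_at_most I' J' K' T' r"
proof -
  obtain a b c where
    "\<forall>i\<in>I. \<forall>j\<in>J. \<forall>k\<in>K. T i j k = (\<Sum>m<r. a m i * b m j * c m k)"
    using assms(1) unfolding rank_at_most_def by blast
  then have "\<forall>i\<in>I'. \<forall>j\<in>J'. \<forall>k\<in>K'. T' i j k = (\<Sum>m<r. a m i * b m j * c m k)"
    using assms(2-) by (simp add: subset_iff)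
  then show ?thesis unfolding rank_at_most_def by blast
qed

text \<open>Terms may be labelled by any finite set, which is convenient for deleting one term or
  joining two decompositions.\<close>

lemma rank_at_most_reindex:
  fixes a :: "'x \<Rightarrow> 'a \<Rightarrow> complex"
  assumes "finite X"
    and "\<forall>i\<in>I. \<forall>j\<in>J. \<forall>k\<in>K. T i j k = (\<Sum>x\<in>X. a x i * b x j * c x k)"
  shows "rank_at_most I J K T (card X)"
proof -
  obtain h where h: "bij_betw h {..<card X} X"
    using ex_bij_betw_nat_finite[OF assms(1)] by (auto simp: atLeast0LessThan)
  have "T i j k = (\<Sum>m<card X. a (h m) i * b (h m) j * c (h m) k)"
    if "i \<in> I" "j \<in> J" "k \<in> K" for i j k
    using assms(2) that sum.reindex_bij_betw[OF h, of "\<lambda>x. a x i * b x j * c x k"] by simp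
  then show ?thesis unfolding rank_at_most_def by meson
qed

lemma rank_at_most_swap12:
  "rank_at_most J I K (\<lambda>j i k. T i j k) r \<longleftrightarrow> rank_at_most I J K T r"
proof -
  \<comment> \<open>The fresh type variables make this implication polymorphic, so that it can be
    applied to its own conclusion for the converse.\<close>
  have "rank_at_most J I K (\<lambda>j i k. T i j k) r"
    if T: "rank_at_most I J K T r" for I :: "'x set" and J :: "'y set" and T
  proof -
    obtain a b c where
      "\<forall>i\<in>I. \<forall>j\<in>J. \<forall>k\<in>K. T i j k = (\<Sum>m<r. a m i * b m j * c m k)"
      using T unfolding rank_at_most_def by blast
    then have "\<forall>j\<in>J. \<forall>i\<in>I. \<forall>k\<in>K. T i j k = (\<Sum>m<r. b m j * a m i * c m k)"
      by (simp add: mult.commute)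
    then show ?thesis unfolding rank_at_most_def by blast
  qed
  from this[of I J T] this[of J I "\<lambda>j i k. T i j k"] show ?thesis by blast
qed

lemma rank_at_most_swap23:
  "rank_at_most I K J (\<lambda>i k j. T i j k) r \<longleftrightarrow> rank_at_most I J K T r"
proof -
  have "rank_at_most I K J (\<lambda>i k j. T i j k) r"
    if T: "rank_at_most I J K T r" for J :: "'y set" and K :: "'z set" and T
  proof -
    obtain a b c where
      "\<forall>i\<in>I. \<forall>j\<in>J. \<forall>k\<in>K. T i j k = (\<Sum>m<r. a m i * b m j * c m k)"
      using T unfolding rank_at_most_def by blast
    then have "\<forall>i\<in>I. \<forall>k\<in>K. \<forall>j\<in>J. T i j k = (\<Sum>m<r. a m i * c m k * b m j)"
      by (simp add: mult.assoc mult.commute[of "b _ _" "c _ _"])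
    then show ?thesis unfolding rank_at_most_def by blast
  qed
  from this[of J K T] this[of K J "\<lambda>i k j. T i j k"] show ?thesis by blast
qed

lemma rank_at_most_rotate:
  "rank_at_most K I J (\<lambda>k i j. T i j k) r \<longleftrightarrow> rank_at_most I J K T r"
  using rank_at_most_swap12[of K I J "\<lambda>i k j. T i j k" r] rank_at_most_swap23[of I K J T r]
  by simp

lemma tensor_rank_eq_Least: "tensor_rank I J K T = (LEAST r. rank_at_most I J K T r)"
  unfolding tensor_rank_def rank_at_most_def simple_tensor_def ..

lemma tensor_rank_le: "rank_at_most I J K T r \<Longrightarrow> tensor_rank I J K T \<le> r"
  unfolding tensor_rank_eq_Least by (rule Least_le)

text \<open>Expansion in unit vectors gives some decomposition, so the minimum defining
  \<open>tensor_rank\<close> is attained.\<close>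

lemma rank_at_most_tensor_rank:
  assumes "finite I" "finite J" "finite K"
  shows "rank_at_most I J K T (tensor_rank I J K T)"
proof -
  have "rank_at_most I J K T (card (I \<times> J \<times> K))"
  proof (rule rank_at_most_reindex; (intro ballI)?)
    fix i j k assume ijk: "i \<in> I" "j \<in> J" "k \<in> K"
    \<comment> \<open>One term for each position \<open>p\<close>; the entry at \<open>p\<close> is
      absorbed into the first vector.\<close>
    let ?a = "\<lambda>p i. if i = fst p then T i (fst (snd p)) (snd (snd p)) else 0"
    let ?b = "\<lambda>p j. if j = fst (snd p) then 1 else 0"
    let ?c = "\<lambda>p k. if k = snd (snd p) then 1 else 0"
    have "(\<Sum>p\<in>I \<times> J \<times> K. ?a p i * ?b p j * ?c p k)
      = (\<Sum>p\<in>I \<times> J \<times> K. if p = (i, j, k) then T i j k else 0)"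
      by (intro sum.cong) auto
    also have "\<dots> = T i j k"
      using ijk assms by (simp add: sum.delta)
    finally show "T i j k = (\<Sum>p\<in>I \<times> J \<times> K. ?a p i * ?b p j * ?c p k)" ..
  qed (use assms in simp)
  then show ?thesis unfolding tensor_rank_eq_Least by (rule LeastI)
qed

text \<open>The easy inequality: extend the vectors of both decompositions by zero and take all
  terms together.\<close>

lemma rank_at_most_direct_sum:
  assumes "rank_at_most I1 J1 K1 T1 r1" "rank_at_most I2 J2 K2 T2 r2"
  shows "rank_at_most (I1 <+> I2) (J1 <+> J2) (K1 <+> K2) (tensor_direct_sum T1 T2) (r1 + r2)"
proof -
  obtain a1 b1 c1 where
    1: "\<forall>i\<in>I1. \<forall>j\<in>J1. \<forall>k\<in>K1. T1 i j k = (\<Sum>m<r1. a1 m i * b1 m j * c1 m k)"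
    using assms(1) unfolding rank_at_most_def by blast
  obtain a2 b2 c2 where
    2: "\<forall>i\<in>I2. \<forall>j\<in>J2. \<forall>k\<in>K2. T2 i j k = (\<Sum>m<r2. a2 m i * b2 m j * c2 m k)"
    using assms(2) unfolding rank_at_most_def by blast
  have "\<forall>i\<in>I1 <+> I2. \<forall>j\<in>J1 <+> J2. \<forall>k\<in>K1 <+> K2.
    tensor_direct_sum T1 T2 i j k = (\<Sum>x\<in>{..<r1} <+> {..<r2}.
      (case (x, i) of (Inl m, Inl i) \<Rightarrow> a1 m i | (Inr m, Inr i) \<Rightarrow> a2 m i | _ \<Rightarrow> 0) *
      (case (x, j) of (Inl m, Inl j) \<Rightarrow> b1 m j | (Inr m, Inr j) \<Rightarrow> b2 m j | _ \<Rightarrow> 0) *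
      (case (x, k) of (Inl m, Inl k) \<Rightarrow> c1 m k | (Inr m, Inr k) \<Rightarrow> c2 m k | _ \<Rightarrow> 0))"
    using 1 2 by (auto simp: sum.Plus)
  from rank_at_most_reindex[OF _ this]
  have "rank_at_most (I1 <+> I2) (J1 <+> J2) (K1 <+> K2) (tensor_direct_sum T1 T2)
      (card ({..<r1} <+> {..<r2}))"
    by simp
  then show ?thesis by (simp add: card_Plus)
qed

section \<open>Eliminating lines of the first block\<close>

text \<open>A nonzero row \<open>y\<close> meets some term; adding multiples of row \<open>y\<close>
  to the other rows makes the second vector of that term vanish on them, so the term
  disappears.\<close>

lemma rank_at_most_eliminate_row:
  assumes "rank_at_most I J K T r" "i0 \<in> I" "y \<in> J" "k0 \<in> K" "T i0 y k0 \<noteq> 0"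
  obtains lam where "0 < r"
    "rank_at_most I (J - {y}) K (\<lambda>i j k. T i j k + lam j * T i y k) (r - 1)"
proof -
  obtain a b c where
    T: "\<forall>i\<in>I. \<forall>j\<in>J. \<forall>k\<in>K. T i j k = (\<Sum>m<r. a m i * b m j * c m k)"
    using assms(1) unfolding rank_at_most_def by blast
  have "(\<Sum>m<r. a m i0 * b m y * c m k0) \<noteq> 0"
    using T assms(2-) by simp
  then obtain m0 where m0: "m0 < r" "b m0 y \<noteq> 0"
    by (metis (no_types, lifting) lessThan_iff mult_zero_left mult_zero_right sum.neutral)
  \<comment> \<open>The solution of \<open>b m0 j + lam j * b m0 y = 0\<close>. It depends on the
    decomposition, hence cannot be prescribed in advance.\<close>
  define lam where "lam j = - b m0 j / b m0 y" for j
  have "T i j k + lam j * T i y k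
      = (\<Sum>m\<in>{..<r} - {m0}. a m i * (b m j + lam j * b m y) * c m k)"
    if "i \<in> I" "j \<in> J - {y}" "k \<in> K" for i j k
  proof -
    have "T i j k + lam j * T i y k = (\<Sum>m<r. a m i * (b m j + lam j * b m y) * c m k)"
      using T that assms(3) by (simp add: sum_distrib_left sum.distrib[symmetric] algebra_simps)
    also have "\<dots> = (\<Sum>m\<in>{..<r} - {m0}. a m i * (b m j + lam j * b m y) * c m k)"
      using m0 by (subst sum.remove[of _ m0]) (auto simp: lam_def)
    finally show ?thesis .
  qed
  then have "\<forall>i\<in>I. \<forall>j\<in>J - {y}. \<forall>k\<in>K. T i j k + lam j * T i y k
      = (\<Sum>m\<in>{..<r} - {m0}. a m i * (b m j + lam j * b m y) * c m k)"
    by blast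
  from rank_at_most_reindex[OF _ this]
  have "rank_at_most I (J - {y}) K (\<lambda>i j k. T i j k + lam j * T i y k)
      (card ({..<r} - {m0}))"
    by simp
  then have "rank_at_most I (J - {y}) K (\<lambda>i j k. T i j k + lam j * T i y k) (r - 1)"
    using m0 by simp
  with m0 show thesis by (intro that[of lam]) auto
qed

lemma rank_at_most_eliminate_column:
  assumes "rank_at_most I J K T r" "i0 \<in> I" "j0 \<in> J" "z \<in> K" "T i0 j0 z \<noteq> 0"
  obtains lam where "0 < r"
    "rank_at_most I J (K - {z}) (\<lambda>i j k. T i j k + lam k * T i j z) (r - 1)"
proof -
  have "rank_at_most I K J (\<lambda>i k j. T i j k) r"
    using assms(1) by (rule rank_at_most_swap23[THEN iffD2])
  from rank_at_most_eliminate_row[OF this assms(2,4,3,5)]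
  obtain lam where lam: "0 < r"
    "rank_at_most I (K - {z}) J (\<lambda>i k j. T i j k + lam k * T i j z) (r - 1)"
    by blast
  have "rank_at_most I J (K - {z}) (\<lambda>i j k. T i j k + lam k * T i j z) (r - 1)"
    using lam(2) rank_at_most_swap23[of I "K - {z}" J "\<lambda>i j k. T i j k + lam k * T i j z"]
    by simp
  with lam(1) show thesis by (rule that)
qed

text \<open>
  \<open>N\<close> is \<open>M \<oplus> T2\<close> polluted by combinations of removed lines; \<open>W\<close> is a set of variables that
  do not occur in the selected lines, so on \<open>W\<close> the eliminations have no effect.
\<close>

lemma rank_at_most_removable:
  fixes N :: "('a1 + 'a2, 'b1 + 'b2, 'c1 + 'c2) tensor"
  assumes "removable I R S ops M" "distinct ops" "set ops \<subseteq> R <+> S"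
    and "rank_at_most (I <+> I2) (R <+> J2) (S <+> K2) N r"
    and "\<And>l s t. l \<in> I \<Longrightarrow> s \<in> R \<Longrightarrow> t \<in> S \<Longrightarrow> N (Inl l) (Inl s) (Inl t) = M s t l"
    and "W \<subseteq> I <+> I2"
    and "\<And>w s y. w \<in> W \<Longrightarrow> Inl s \<in> set ops \<Longrightarrow> y \<in> S <+> K2 \<Longrightarrow> N w (Inl s) y = 0"
    and "\<And>w x t. w \<in> W \<Longrightarrow> Inr t \<in> set ops \<Longrightarrow> x \<in> R <+> J2 \<Longrightarrow> N w x (Inl t) = 0"
  shows "length ops \<le> r \<and>
    rank_at_most W ((R - {s. Inl s \<in> set ops}) <+> J2) ((S - {t. Inr t \<in> set ops}) <+> K2) N
      (r - length ops)"
  using assms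
proof (induction I R S ops M arbitrary: N r rule: removable.induct)
  case (1 I R S M)
  \<comment> \<open>Only when all lines are removed are the variables outside \<open>W\<close> set
    to zero; until then they may be needed to see that a line is nonzero.\<close>
  from 1(4) have "rank_at_most W (R <+> J2) (S <+> K2) N r"
    by (rule rank_at_most_cong) (use 1(6) in auto)
  then show ?case by simp
next
  case (2 I R S q ops M)
  have q: "q \<in> R" "Inl q \<notin> set ops" using "2.prems" by auto
  obtain t0 l0 where "t0 \<in> S" "l0 \<in> I" "N (Inl l0) (Inl q) (Inl t0) \<noteq> 0"
    using "2.prems"(1,5) q(1) by auto
  with rank_at_most_eliminate_row[OF "2.prems"(4), of "Inl l0" "Inl q" "Inl t0"] q(1)
  obtain lam where lam: "0 < r" "rank_at_most (I <+> I2) ((R <+> J2) - {Inl q}) (S <+> K2)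
      (\<lambda>i j k. N i j k + lam j * N i (Inl q) k) (r - 1)"
    by auto
  define N' where "N' = (\<lambda>i j k. N i j k + lam j * N i (Inl q) k)"
  \<comment> \<open>The removed row is selected, so it vanishes on \<open>W\<close> and adding
    multiples of it changes nothing there, not even in the rows of \<open>T2\<close>.\<close>
  have W: "N' w j k = N w j k" if "w \<in> W" "k \<in> S <+> K2" for w j k
    using "2.prems"(7)[OF that(1), of q k] that by (simp add: N'_def)
  have eq: "(R <+> J2) - {Inl q} = (R - {q}) <+> J2" by auto
  have "length ops \<le> r - 1 \<and> rank_at_most W ((R - {q} - {s. Inl s \<in> set ops}) <+> J2)
      ((S - {t. Inr t \<in> set ops}) <+> K2) N' (r - 1 - length ops)"
  proof (rule "2.IH")
    \<comment> \<open>Here the quantification over all multiples in \<open>removable\<close> is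
      used: \<open>lam\<close> was dictated by the decomposition. Only its values on the first
      summand affect \<open>M\<close>.\<close>
    show "removable I (R - {q}) S ops (\<lambda>s t l. M s t l + lam (Inl s) * M q t l)"
      using "2.prems"(1) by simp
    show "distinct ops" "set ops \<subseteq> (R - {q}) <+> S"
      using "2.prems"(2,3) q(2) by auto
    show "rank_at_most (I <+> I2) ((R - {q}) <+> J2) (S <+> K2) N' (r - 1)"
      using lam(2) by (simp add: N'_def eq)
    show "N' (Inl l) (Inl s) (Inl t) = M s t l + lam (Inl s) * M q t l"
      if "l \<in> I" "s \<in> R - {q}" "t \<in> S" for l s t
      using that q(1) "2.prems"(5) by (simp add: N'_def)
    show "W \<subseteq> I <+> I2" by fact
    show "N' w (Inl s) y = 0" if "w \<in> W" "Inl s \<in> set ops" "y \<in> S <+> K2" for w s y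
      using that "2.prems"(7) W by simp
    show "N' w x (Inl t) = 0" if "w \<in> W" "Inr t \<in> set ops" "x \<in> (R - {q}) <+> J2" for w x t
    proof -
      have "t \<in> S" using that(2) "2.prems"(3) by auto
      then have "N' w x (Inl t) = N w x (Inl t)"
        using W[OF that(1)] by blast
      with that "2.prems"(8)[OF that(1), of t x] show ?thesis by auto
    qed
  qed
  then have IH: "length ops \<le> r - 1"
    "rank_at_most W ((R - {q} - {s. Inl s \<in> set ops}) <+> J2)
      ((S - {t. Inr t \<in> set ops}) <+> K2) N' (r - 1 - length ops)" by simp_all
  \<comment> \<open>On \<open>W\<close> the tensors \<open>N'\<close> and \<open>N\<close> agree, so
    the pollution is gone from the conclusion.\<close>
  from IH(2) have "rank_at_most W ((R - {s. Inl s \<in> set (Inl q # ops)}) <+> J2)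
      ((S - {t. Inr t \<in> set (Inl q # ops)}) <+> K2) N (r - 1 - length ops)"
  proof (rule rank_at_most_cong)
    show "N w j k = N' w j k" if "w \<in> W" "k \<in> (S - {t. Inr t \<in> set (Inl q # ops)}) <+> K2"
      for w j k
    proof -
      have "k \<in> S <+> K2" using that(2) by auto
      with W[OF that(1)] show ?thesis by simp
    qed
  qed auto
  \<comment> \<open>Subtraction is truncated: \<open>0 < r\<close> is what turns
    \<open>length ops \<le> r - 1\<close> into the bound for one more line.\<close>
  with IH(1) lam(1) show ?case by simp
next
  \<comment> \<open>The mirror image of the row case, with the last two factors exchanged.\<close>
  case (3 I R S q ops M)
  have q: "q \<in> S" "Inr q \<notin> set ops" using "3.prems" by auto
  obtain s0 l0 where "s0 \<in> R" "l0 \<in> I" "N (Inl l0) (Inl s0) (Inl q) \<noteq> 0"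
    using "3.prems"(1,5) q(1) by auto
  with rank_at_most_eliminate_column[OF "3.prems"(4), of "Inl l0" "Inl s0" "Inl q"] q(1)
  obtain lam where lam: "0 < r" "rank_at_most (I <+> I2) (R <+> J2) ((S <+> K2) - {Inl q})
      (\<lambda>i j k. N i j k + lam k * N i j (Inl q)) (r - 1)"
    by auto
  define N' where "N' = (\<lambda>i j k. N i j k + lam k * N i j (Inl q))"
  have W: "N' w j k = N w j k" if "w \<in> W" "j \<in> R <+> J2" for w j k
    using "3.prems"(8)[OF that(1), of q j] that by (simp add: N'_def)
  have eq: "(S <+> K2) - {Inl q} = (S - {q}) <+> K2" by auto
  have "length ops \<le> r - 1 \<and> rank_at_most W ((R - {s. Inl s \<in> set ops}) <+> J2)
      ((S - {q} - {t. Inr t \<in> set ops}) <+> K2) N' (r - 1 - length ops)"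
  proof (rule "3.IH")
    show "removable I R (S - {q}) ops (\<lambda>s t l. M s t l + lam (Inl t) * M s q l)"
      using "3.prems"(1) by simp
    show "distinct ops" "set ops \<subseteq> R <+> (S - {q})"
      using "3.prems"(2,3) q(2) by auto
    show "rank_at_most (I <+> I2) (R <+> J2) ((S - {q}) <+> K2) N' (r - 1)"
      using lam(2) by (simp add: N'_def eq)
    show "N' (Inl l) (Inl s) (Inl t) = M s t l + lam (Inl t) * M s q l"
      if "l \<in> I" "s \<in> R" "t \<in> S - {q}" for l s t
      using that q(1) "3.prems"(5) by (simp add: N'_def)
    show "W \<subseteq> I <+> I2" by fact
    show "N' w x (Inl t) = 0" if "w \<in> W" "Inr t \<in> set ops" "x \<in> R <+> J2" for w x t
      using that "3.prems"(8) W by simp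
    show "N' w (Inl s) y = 0" if "w \<in> W" "Inl s \<in> set ops" "y \<in> (S - {q}) <+> K2" for w s y
    proof -
      have "s \<in> R" using that(2) "3.prems"(3) by auto
      then have "N' w (Inl s) y = N w (Inl s) y"
        using W[OF that(1)] by blast
      with that "3.prems"(7)[OF that(1), of s y] show ?thesis by auto
    qed
  qed
  then have IH: "length ops \<le> r - 1"
    "rank_at_most W ((R - {s. Inl s \<in> set ops}) <+> J2)
      ((S - {q} - {t. Inr t \<in> set ops}) <+> K2) N' (r - 1 - length ops)" by simp_all
  from IH(2) have "rank_at_most W ((R - {s. Inl s \<in> set (Inr q # ops)}) <+> J2)
      ((S - {t. Inr t \<in> set (Inr q # ops)}) <+> K2) N (r - 1 - length ops)"
  proof (rule rank_at_most_cong)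
    show "N w j k = N' w j k" if "w \<in> W" "j \<in> (R - {s. Inl s \<in> set (Inr q # ops)}) <+> J2"
      for w j k
    proof -
      have "j \<in> R <+> J2" using that(2) by auto
      with W[OF that(1)] show ?thesis by simp
    qed
  qed auto
  with IH(1) lam(1) show ?case by simp
qed

section \<open>Direct sums under permutations and linear maps of the factors\<close>

lemma tensor_direct_sum_zero [simp]:
  "tensor_direct_sum T1 T2 x (Inl j) (Inr k) = 0"
  "tensor_direct_sum T1 T2 x (Inr j) (Inl k) = 0"
  "tensor_direct_sum T1 T2 (Inl i) y (Inr k) = 0"
  "tensor_direct_sum T1 T2 (Inr i) y (Inl k) = 0"
  "tensor_direct_sum T1 T2 (Inl i) (Inr j) z = 0"
  "tensor_direct_sum T1 T2 (Inr i) (Inl j) z = 0"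
  by (cases x; cases y; cases z; simp)+

lemma tensor_direct_sum_swap12:
  "(\<lambda>j i k. tensor_direct_sum T1 T2 i j k) =
    tensor_direct_sum (\<lambda>j i k. T1 i j k) (\<lambda>j i k. T2 i j k)"
proof (intro ext)
  fix j i k
  show "tensor_direct_sum T1 T2 i j k =
      tensor_direct_sum (\<lambda>j i k. T1 i j k) (\<lambda>j i k. T2 i j k) j i k"
    by (cases i; cases j; cases k) simp_all
qed

lemma tensor_direct_sum_rotate:
  "(\<lambda>k i j. tensor_direct_sum T1 T2 i j k) =
    tensor_direct_sum (\<lambda>k i j. T1 i j k) (\<lambda>k i j. T2 i j k)"
proof (intro ext)
  fix k i j
  show "tensor_direct_sum T1 T2 i j k =
      tensor_direct_sum (\<lambda>k i j. T1 i j k) (\<lambda>k i j. T2 i j k) k i j"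
    by (cases i; cases j; cases k) simp_all
qed

text \<open>Together with the rotation below, this transports results on the first factor to the
  other two.\<close>

lemma rank_at_most_direct_sum_swap12:
  "rank_at_most (J <+> J2) (I <+> I2) (K <+> K2)
      (tensor_direct_sum (\<lambda>j i k. T i j k) (\<lambda>j i k. T2 i j k)) r \<longleftrightarrow>
    rank_at_most (I <+> I2) (J <+> J2) (K <+> K2) (tensor_direct_sum T T2) r"
  using rank_at_most_swap12[of "J <+> J2" "I <+> I2" "K <+> K2" "tensor_direct_sum T T2" r]
  by (simp only: tensor_direct_sum_swap12)

lemma rank_at_most_direct_sum_rotate:
  "rank_at_most (K <+> K2) (I <+> I2) (J <+> J2)
      (tensor_direct_sum (\<lambda>k i j. T i j k) (\<lambda>k i j. T2 i j k)) r \<longleftrightarrow>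
    rank_at_most (I <+> I2) (J <+> J2) (K <+> K2) (tensor_direct_sum T T2) r"
  using rank_at_most_rotate[of "K <+> K2" "I <+> I2" "J <+> J2" "tensor_direct_sum T T2" r]
  by (simp only: tensor_direct_sum_rotate)

text \<open>The linear map that is \<open>L\<close> on the first summand and the identity on the
  second sends simple tensors to simple tensors.\<close>

lemma rank_at_most_transform_first:
  assumes "rank_at_most (I <+> I2) (J <+> J2) (K <+> K2) (tensor_direct_sum T T2) r"
  shows "rank_at_most (I' <+> I2) (J <+> J2) (K <+> K2)
    (tensor_direct_sum (\<lambda>s j k. \<Sum>i\<in>I. T i j k * L s i) T2) r"
proof -
  obtain a b c where abc:
    "\<forall>i\<in>I <+> I2. \<forall>j\<in>J <+> J2. \<forall>k\<in>K <+> K2.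
      tensor_direct_sum T T2 i j k = (\<Sum>m<r. a m i * b m j * c m k)"
    using assms unfolding rank_at_most_def by blast
  \<comment> \<open>The image of \<open>a m\<close> under this map.\<close>
  define a' where
    "a' m = case_sum (\<lambda>s. \<Sum>i\<in>I. a m (Inl i) * L s i) (\<lambda>i. a m (Inr i))" for m
  have *: "(\<Sum>i\<in>I. tensor_direct_sum T T2 (Inl i) j k * L s i)
      = (\<Sum>m<r. a' m (Inl s) * b m j * c m k)"
    if "j \<in> J <+> J2" "k \<in> K <+> K2" for s j k
  proof -
    have "tensor_direct_sum T T2 (Inl i) j k = (\<Sum>m<r. a m (Inl i) * b m j * c m k)"
      if "i \<in> I" for i
      using abc that \<open>j \<in> J <+> J2\<close> \<open>k \<in> K <+> K2\<close> by blast
    then have "(\<Sum>i\<in>I. tensor_direct_sum T T2 (Inl i) j k * L s i)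
        = (\<Sum>i\<in>I. \<Sum>m<r. a m (Inl i) * L s i * b m j * c m k)"
      by (intro sum.cong) (simp_all add: sum_distrib_left mult_ac)
    also have "\<dots> = (\<Sum>m<r. \<Sum>i\<in>I. a m (Inl i) * L s i * b m j * c m k)"
      by (rule sum.swap)
    finally show ?thesis by (simp add: a'_def sum_distrib_right)
  qed
  have "tensor_direct_sum (\<lambda>s j k. \<Sum>i\<in>I. T i j k * L s i) T2 x j k
      = (\<Sum>m<r. a' m x * b m j * c m k)"
    if "x \<in> I' <+> I2" "j \<in> J <+> J2" "k \<in> K <+> K2" for x j k
  proof (cases x)
    case (Inl s)
    with *[OF that(2,3), of s] show ?thesis by (cases j; cases k) simp_all
  next
    case (Inr i)
    then have "tensor_direct_sum (\<lambda>s j k. \<Sum>i\<in>I. T i j k * L s i) T2 x j k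
        = tensor_direct_sum T T2 (Inr i) j k" by (cases j; cases k) simp_all
    moreover have "Inr i \<in> I <+> I2" using Inr that(1) by auto
    then have "tensor_direct_sum T T2 (Inr i) j k = (\<Sum>m<r. a m (Inr i) * b m j * c m k)"
      using abc that(2,3) by blast
    ultimately show ?thesis by (simp add: a'_def Inr)
  qed
  then show ?thesis unfolding rank_at_most_def by blast
qed

lemma rank_at_most_transform_second:
  assumes "rank_at_most (I <+> I2) (J <+> J2) (K <+> K2) (tensor_direct_sum T T2) r"
  shows "rank_at_most (I <+> I2) (J' <+> J2) (K <+> K2)
    (tensor_direct_sum (\<lambda>i s k. \<Sum>j\<in>J. T i j k * L s j) T2) r"
proof -
  have "rank_at_most (J <+> J2) (I <+> I2) (K <+> K2)
      (tensor_direct_sum (\<lambda>j i k. T i j k) (\<lambda>j i k. T2 i j k)) r"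
    using assms by (rule rank_at_most_direct_sum_swap12[THEN iffD2])
  from rank_at_most_transform_first[OF this] show ?thesis
    by (rule rank_at_most_direct_sum_swap12[THEN iffD1])
qed

lemma rank_at_most_transform_third:
  assumes "rank_at_most (I <+> I2) (J <+> J2) (K <+> K2) (tensor_direct_sum T T2) r"
  shows "rank_at_most (I <+> I2) (J <+> J2) (K' <+> K2)
    (tensor_direct_sum (\<lambda>i j t. \<Sum>k\<in>K. T i j k * L t k) T2) r"
proof -
  have "rank_at_most (K <+> K2) (I <+> I2) (J <+> J2)
      (tensor_direct_sum (\<lambda>k i j. T i j k) (\<lambda>k i j. T2 i j k)) r"
    using assms by (rule rank_at_most_direct_sum_rotate[THEN iffD2])
  from rank_at_most_transform_first[OF this] show ?thesis
    by (rule rank_at_most_direct_sum_rotate[THEN iffD1])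
qed

section \<open>Change of bases\<close>

text \<open>Coordinates are linear functionals of the vector: \<open>D\<close> is the inverse of the
  matrix \<open>a\<close>. Spanning yields \<open>D\<close>, and independence makes its formula hold
  for every coordinate family \<open>c\<close>.\<close>

lemma is_basis_coordinates:
  assumes "finite I" "is_basis I a"
  obtains D where
    "\<And>v c. (\<forall>i\<in>I. v i = (\<Sum>l\<in>I. c l * a l i)) \<Longrightarrow> \<forall>l\<in>I. c l = (\<Sum>i\<in>I. v i * D l i)"
proof -
  have "\<exists>c. \<forall>i\<in>I. (if i = x then 1 else 0) = (\<Sum>l\<in>I. c l * a l i)" for x
    using assms(2)[unfolded is_basis_def, THEN conjunct2, THEN spec,
      of "\<lambda>i. if i = x then 1 else 0"] .
  then obtain D where D: "\<And>x i. i \<in> I \<Longrightarrow> (\<Sum>l\<in>I. D x l * a l i) = (if i = x then 1 else 0)"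
    by metis
  have "\<forall>l\<in>I. c l = (\<Sum>i\<in>I. v i * D i l)" if v: "\<forall>i\<in>I. v i = (\<Sum>l\<in>I. c l * a l i)" for v c
  proof -
    \<comment> \<open>Two expansions of \<open>v\<close> are compared; their difference is a
      relation among the basis vectors.\<close>
    have "(\<Sum>l\<in>I. (c l - (\<Sum>x\<in>I. v x * D x l)) * a l i) = 0" if i: "i \<in> I" for i
    proof -
      have "(\<Sum>l\<in>I. (\<Sum>x\<in>I. v x * D x l) * a l i) = (\<Sum>l\<in>I. \<Sum>x\<in>I. v x * (D x l * a l i))"
        by (simp add: sum_distrib_right mult.assoc)
      also have "\<dots> = (\<Sum>x\<in>I. v x * (\<Sum>l\<in>I. D x l * a l i))"
        by (subst sum.swap) (simp add: sum_distrib_left)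
      also have "\<dots> = (\<Sum>x\<in>I. if i = x then v x else 0)"
        using D[OF i] by (intro sum.cong) auto
      also have "\<dots> = v i" using i assms(1) by simp
      finally show ?thesis
        using v i by (simp add: left_diff_distrib sum_subtractf)
    qed
    then have "\<forall>l\<in>I. c l - (\<Sum>x\<in>I. v x * D x l) = 0"
      using assms(2)[unfolded is_basis_def, THEN conjunct1, rule_format,
        where c = "\<lambda>l. c l - (\<Sum>x\<in>I. v x * D x l)"] by blast
    then show ?thesis by simp
  qed
  then show thesis by (rule that[of "\<lambda>l i. D i l"])
qed

text \<open>\<open>M\<close> arises from \<open>T\<close> by one linear map on each factor:
  contraction with \<gamma> and with \<beta>, then taking coordinates with respect to
  \<open>a\<close>. None of them touches \<open>T2\<close>.\<close>

lemma rank_at_most_represents: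
  assumes "finite I" "is_basis I a" "represents I J K T a \<beta> \<gamma> M"
    and "rank_at_most (I <+> I2) (J <+> J2) (K <+> K2) (tensor_direct_sum T T2) r"
  shows "rank_at_most (I <+> I2) (J <+> J2) (K <+> K2)
    (tensor_direct_sum (\<lambda>l s t. M s t l) T2) r"
proof -
  obtain D where D:
    "\<And>v c. (\<forall>i\<in>I. v i = (\<Sum>l\<in>I. c l * a l i)) \<Longrightarrow> \<forall>l\<in>I. c l = (\<Sum>i\<in>I. v i * D l i)"
    using is_basis_coordinates[OF assms(1,2)] by blast
  have M: "M s t l = (\<Sum>i\<in>I. (\<Sum>j\<in>J. (\<Sum>k\<in>K. T i j k * \<gamma> t k) * \<beta> s j) * D l i)"
    if "l \<in> I" "s \<in> J" "t \<in> K" for l s t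
  proof -
    have "\<forall>i\<in>I. contract J K T (\<beta> s) (\<gamma> t) i = (\<Sum>l\<in>I. M s t l * a l i)"
      using assms(3) that unfolding represents_def by blast
    from D[OF this] that have "M s t l = (\<Sum>i\<in>I. contract J K T (\<beta> s) (\<gamma> t) i * D l i)"
      by blast
    then show ?thesis
      by (simp add: contract_def sum_distrib_left mult_ac)
  qed
  have "rank_at_most (I <+> I2) (J <+> J2) (K <+> K2) (tensor_direct_sum
      (\<lambda>l s t. \<Sum>i\<in>I. (\<Sum>j\<in>J. (\<Sum>k\<in>K. T i j k * \<gamma> t k) * \<beta> s j) * D l i) T2) r"
    by (intro rank_at_most_transform_first rank_at_most_transform_second
        rank_at_most_transform_third assms)
  then show ?thesis
    by (rule rank_at_most_cong) (auto simp: M)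
qed

section \<open>From one round to a sequence of rounds\<close>

lemma subst_round_rank_at_most:
  assumes "subst_round I J K T p q I' J' K' T'" "finite I" "finite J" "finite K"
    and "rank_at_most (I <+> I2) (J <+> J2) (K <+> K2) (tensor_direct_sum T T2) r"
  shows "p + q \<le> r"
    "rank_at_most (I' <+> I2) (J' <+> J2) (K' <+> K2) (tensor_direct_sum T' T2) (r - (p + q))"
proof -
  obtain a \<beta> \<gamma> M P Q ops where
    rep: "is_basis I a" "represents I J K T a \<beta> \<gamma> M"
    and PQ: "P \<subseteq> J" "card P = p" "Q \<subseteq> K" "card Q = q"
    and ops: "distinct ops" "set ops = P <+> Q" "removable I J K ops M"
    and new: "I' = surviving I J K P Q M" "J' = J - P" "K' = K - Q"
      "\<forall>l\<in>I'. \<forall>s\<in>J'. \<forall>t\<in>K'. T' l s t = M s t l"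
    using assms(1) unfolding subst_round_def by metis
  have "finite P" "finite Q" using PQ assms by (auto intro: finite_subset)
  then have len: "length ops = p + q"
    using PQ ops(1,2) by (simp flip: distinct_card add: card_Plus)
  let ?N = "tensor_direct_sum (\<lambda>l s t. M s t l) T2"
  \<comment> \<open>The set \<open>W\<close> is taken to be the surviving variables of the first
    block together with all those of \<open>T2\<close>.\<close>
  have *: "length ops \<le> r \<and>
    rank_at_most (I' <+> I2) ((J - {s. Inl s \<in> set ops}) <+> J2)
      ((K - {t. Inr t \<in> set ops}) <+> K2) ?N (r - length ops)"
  proof (rule rank_at_most_removable)
    show "removable I J K ops M" "distinct ops" by fact+
    show "set ops \<subseteq> J <+> K" using ops(2) PQ by auto
    show "rank_at_most (I <+> I2) (J <+> J2) (K <+> K2) ?N r"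
      by (rule rank_at_most_represents) (use rep assms in auto)
    show "I' <+> I2 \<subseteq> I <+> I2" using new(1) by (auto simp: surviving_def)
    \<comment> \<open>Surviving variables avoid the selected lines by definition; variables of
      \<open>T2\<close> avoid them because these lines pass through the first block.\<close>
    show "?N w (Inl s) y = 0" if "w \<in> I' <+> I2" "Inl s \<in> set ops" "y \<in> K <+> K2" for w s y
      using that ops(2) new(1) by (auto simp: surviving_def)
    show "?N w x (Inl t) = 0" if "w \<in> I' <+> I2" "Inr t \<in> set ops" "x \<in> J <+> J2" for w x t
      using that ops(2) new(1) by (auto simp: surviving_def)
  qed simp
  then show "p + q \<le> r" by (simp add: len)
  have "rank_at_most (I' <+> I2) (J' <+> J2) (K' <+> K2) ?N (r - (p + q))"
  proof -
    have "{s. Inl s \<in> set ops} = P" "{t. Inr t \<in> set ops} = Q" using ops(2) by auto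
    with * show ?thesis by (simp add: len new(2,3))
  qed
  then show "rank_at_most (I' <+> I2) (J' <+> J2) (K' <+> K2) (tensor_direct_sum T' T2)
      (r - (p + q))"
    by (rule rank_at_most_cong) (use new(4) in auto)
qed

lemma subst_round_finite:
  assumes "subst_round I J K T p q I' J' K' T'" "finite I" "finite J" "finite K"
  shows "finite I'" "finite J'" "finite K'"
  using assms unfolding subst_round_def surviving_def by auto

text \<open>Each round uses up its share of the \<open>r\<close> terms while \<open>T2\<close> stays
  intact. Hence \<open>r\<close> is generalised in the induction.\<close>

lemma subst_bound_rank_at_most:
  assumes "subst_bound I J K T n" "finite I" "finite J" "finite K"
    and "rank_at_most (I <+> I2) (J <+> J2) (K <+> K2) (tensor_direct_sum T T2) r"
  shows "n \<le> r \<and> rank_at_most I2 J2 K2 T2 (r - n)"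
  using assms
proof (induction arbitrary: r rule: subst_bound.induct)
  case (zero I J K T)
  obtain a b c where abc:
    "\<forall>i\<in>I <+> I2. \<forall>j\<in>J <+> J2. \<forall>k\<in>K <+> K2.
      tensor_direct_sum T T2 i j k = (\<Sum>m<r. a m i * b m j * c m k)"
    using zero.prems unfolding rank_at_most_def by blast
  \<comment> \<open>Once the first block is exhausted, restriction to the second summands leaves a
    decomposition of \<open>T2\<close> by the remaining terms.\<close>
  have "T2 i j k = (\<Sum>m<r. a m (Inr i) * b m (Inr j) * c m (Inr k))"
    if "i \<in> I2" "j \<in> J2" "k \<in> K2" for i j k
    using abc[rule_format, of "Inr i" "Inr j" "Inr k"] that by auto
  then have "rank_at_most I2 J2 K2 T2 r"
    unfolding rank_at_most_def
    by (intro exI[of _ "\<lambda>m i. a m (Inr i)"] exI[of _ "\<lambda>m j. b m (Inr j)"]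
        exI[of _ "\<lambda>m k. c m (Inr k)"]) blast
  then show ?case by simp
next
  case (round_A I J K T p q I' J' K' T' n)
  note step = subst_round_rank_at_most[OF round_A.hyps(1) round_A.prems]
  have "n \<le> r - (p + q) \<and> rank_at_most I2 J2 K2 T2 (r - (p + q) - n)"
    using round_A.IH subst_round_finite[OF round_A.hyps(1)] round_A.prems step(2) by blast
  with step(1) show ?case by (auto simp: add.assoc)
next
  case (round_B J I K T p q J' I' K' T' n)
  \<comment> \<open>The distinguished factor is brought to the front for the round, and the original
    order is restored afterwards.\<close>
  have "rank_at_most (J <+> J2) (I <+> I2) (K <+> K2)
      (tensor_direct_sum (\<lambda>j i k. T i j k) (\<lambda>j i k. T2 i j k)) r"
    using round_B.prems(4) by (rule rank_at_most_direct_sum_swap12[THEN iffD2])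
  note step = subst_round_rank_at_most[OF round_B.hyps(1) round_B.prems(2,1,3) this]
  have "n \<le> r - (p + q) \<and> rank_at_most I2 J2 K2 T2 (r - (p + q) - n)"
    using round_B.IH subst_round_finite[OF round_B.hyps(1)] round_B.prems
      rank_at_most_direct_sum_swap12[THEN iffD1, OF step(2)] by blast
  with step(1) show ?case by (auto simp: add.assoc)
next
  case (round_C K I J T p q K' I' J' T' n)
  have "rank_at_most (K <+> K2) (I <+> I2) (J <+> J2)
      (tensor_direct_sum (\<lambda>k i j. T i j k) (\<lambda>k i j. T2 i j k)) r"
    using round_C.prems(4) by (rule rank_at_most_direct_sum_rotate[THEN iffD2])
  note step = subst_round_rank_at_most[OF round_C.hyps(1) round_C.prems(3,1,2) this]
  have "n \<le> r - (p + q) \<and> rank_at_most I2 J2 K2 T2 (r - (p + q) - n)"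
    using round_C.IH subst_round_finite[OF round_C.hyps(1)] round_C.prems
      rank_at_most_direct_sum_rotate[THEN iffD1, OF step(2)] by blast
  with step(1) show ?case by (auto simp: add.assoc)
qed

section \<open>Additivity of the rank\<close>

theorem theorem4p1:
  fixes T1 :: "('a1, 'b1, 'c1) tensor" and T2 :: "('a2, 'b2, 'c2) tensor"
    and I1 :: "'a1 set" and J1 :: "'b1 set" and K1 :: "'c1 set"
    and I2 :: "'a2 set" and J2 :: "'b2 set" and K2 :: "'c2 set"
  assumes "finite I1" "finite J1" "finite K1"
    and "finite I2" "finite J2" "finite K2"
    and "rank_determined_by_substitution I1 J1 K1 T1"
  shows "tensor_rank (I1 <+> I2) (J1 <+> J2) (K1 <+> K2) (tensor_direct_sum T1 T2)
    = tensor_rank I1 J1 K1 T1 + tensor_rank I2 J2 K2 T2"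
proof (rule antisym)
  show "tensor_rank (I1 <+> I2) (J1 <+> J2) (K1 <+> K2) (tensor_direct_sum T1 T2)
      \<le> tensor_rank I1 J1 K1 T1 + tensor_rank I2 J2 K2 T2"
    by (intro tensor_rank_le rank_at_most_direct_sum rank_at_most_tensor_rank assms)
next
  let ?r = "tensor_rank (I1 <+> I2) (J1 <+> J2) (K1 <+> K2) (tensor_direct_sum T1 T2)"
  have "rank_at_most (I1 <+> I2) (J1 <+> J2) (K1 <+> K2) (tensor_direct_sum T1 T2) ?r"
    by (intro rank_at_most_tensor_rank finite_Plus assms)
  \<comment> \<open>Sharpness enters here: the number of terms used up by the rounds is R(T1)
    itself.\<close>
  from subst_bound_rank_at_most[OF assms(7)[unfolded rank_determined_by_substitution_def]
      assms(1-3) this]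
  have *: "tensor_rank I1 J1 K1 T1 \<le> ?r"
    "rank_at_most I2 J2 K2 T2 (?r - tensor_rank I1 J1 K1 T1)"
    by simp_all
  \<comment> \<open>The first inequality ensures that the difference bounding R(T2) is not
    truncated.\<close>
  from *(1) tensor_rank_le[OF *(2)]
  show "tensor_rank I1 J1 K1 T1 + tensor_rank I2 J2 K2 T2 \<le> ?r" by linarith
qed

end
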